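(* Let $V(N)$ be the stationary speed of the $N$-counter system. As $N\to\infty$, $$V(N)\le (1+o(1))\left(1+\frac{7}{27}\right).$$
   Context: The $N$-counter system: there are $N$ counters taking integer values. At every time step $t=0,1,2,\ldots$ an (unordered) pair of distinct counters is selected uniformly at random among the $\binom N2$ pairs, independently over steps. If the states of the two selected counters are different, the smaller one is increased by $1$; if they are equal, both are increased by $1$. It is assumed that the system starts from a configuration with at least two counters at the highest level; then at all times there are at least two counters at the highest level. Gap process: order the counters from largest to smallest; for $j=1,\ldots,N-2$ let $X_j(t)\ge 0$ be the difference between the values of the $(j+1)$-th largest and the $(j+2)$-th largest counter after $t$ steps. For $N\ge 3$, $X(t)=(X_1(t),\ldots,X_{N-2}(t))$ is a positive recurrent Markov chain on $\mathbb{Z}_+^{N-2}$ with stationary distribution $\pi$. Speed: $V(N)$ is the expected number of counters updated (increased) in one time step when $X(0)$ is distributed according to $\pi$. Explicitly, if a state $x\in\mathbb{Z}_+^{N-2}$ corresponds to counters occupying $M$ distinct levels with $\alpha_1\ge 2$ counters at the highest level, $\alpha_2\ge1$ at the next occupied level, and so on up to $\alpha_M\ge 1$ at the lowest one ($\alpha_1+\cdots+\alpha_M=N$), then the expected number of counters updated from $x$ is $V_\alpha(N)=1+\sum_{i=1}^M\frac{\alpha_i(\alpha_i-1)}{N(N-1)}$, and $V(N)=\sum_{x}\pi(x)V_{\alpha(x)}(N)$. Here $o(1)$ denotes a quantity tending to $0$ as $N\to\infty$. *)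

theory Defs
  imports "HOL-Probability.Probability" "HOL-Combinatorics.Permutations"
begin

definition counter_pairs :: "nat \<Rightarrow> nat set set" where
  "counter_pairs N = {P. P \<subseteq> {..<N} \<and> card P = 2}"

text \<open>For a pair \<open>P\<close> of counters, the set below is the counter of \<open>P\<close> with the smaller value if
  the two values differ, and all of \<open>P\<close> if they are equal.\<close>

definition updated :: "(nat \<Rightarrow> int) \<Rightarrow> nat set \<Rightarrow> nat set" where
  "updated c P = {k \<in> P. \<forall>l\<in>P. c k \<le> c l}"

definition update :: "(nat \<Rightarrow> int) \<Rightarrow> nat set \<Rightarrow> nat \<Rightarrow> int" where
  "update c P = (\<lambda>k. if k \<in> updated c P then c k + 1 else c k)"

definition descending :: "nat \<Rightarrow> (nat \<Rightarrow> int) \<Rightarrow> int list" where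
  "descending N c = rev (sort (map c [0..<N]))"

text \<open>The list of \<open>X\<^sub>1, \<dots>, X\<^sub>N\<^sub>-\<^sub>2\<close>. List positions start at 0, so the \<open>(j+1)\<close>-th largest value is at
  position \<open>j\<close>.\<close>

definition gaps :: "nat \<Rightarrow> (nat \<Rightarrow> int) \<Rightarrow> nat list" where
  "gaps N c = map (\<lambda>j. nat (descending N c ! j - descending N c ! (j + 1))) [1..<N - 1]"

text \<open>A representative of the configurations with gap vector \<open>x\<close>: counters \<open>0\<close> and \<open>1\<close> are both at
  the highest level, which is normalised to 0, and counter \<open>k \<ge> 1\<close> is at level
  \<open>- (X\<^sub>1 + \<dots> + X\<^sub>k\<^sub>-\<^sub>1)\<close>.\<close>

definition configuration :: "nat list \<Rightarrow> nat \<Rightarrow> int" where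
  "configuration x k = - int (sum_list (take (k - 1) x))"

definition gap_kernel :: "nat \<Rightarrow> nat list \<Rightarrow> nat list pmf" where
  "gap_kernel N x =
     map_pmf (\<lambda>P. gaps N (update (configuration x) P)) (pmf_of_set (counter_pairs N))"

definition stationary :: "nat \<Rightarrow> nat list pmf \<Rightarrow> bool" where
  "stationary N \<pi> \<longleftrightarrow>
     set_pmf \<pi> \<subseteq> {x. length x = N - 2} \<and> bind_pmf \<pi> (gap_kernel N) = \<pi>"

definition expected_updates :: "nat \<Rightarrow> (nat \<Rightarrow> int) \<Rightarrow> real" where
  "expected_updates N c =
     measure_pmf.expectation (pmf_of_set (counter_pairs N)) (\<lambda>P. real (card (updated c P)))"

definition speed :: "nat \<Rightarrow> nat list pmf \<Rightarrow> real" where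
  "speed N \<pi> = measure_pmf.expectation \<pi> (\<lambda>x. expected_updates N (configuration x))"

lemma finite_counter_pairs [simp]: "finite (counter_pairs N)"
  by (rule finite_subset[of _ "Pow {..<N}"]) (auto simp: counter_pairs_def)

lemma counter_pairs_nonempty:
  assumes "N \<ge> 2" shows "counter_pairs N \<noteq> {}"
proof -
  have "{0, 1} \<in> counter_pairs N" using assms by (auto simp: counter_pairs_def)
  then show ?thesis by blast
qed

lemma card_counter_pairs: "card (counter_pairs N) = N choose 2"
  unfolding counter_pairs_def using n_subsets[of "{..<N}" 2] by simp

lemma length_descending [simp]: "length (descending N c) = N"
  by (simp add: descending_def)

lemma mset_descending: "mset (descending N c) = image_mset c (mset_set {..<N})"
  by (simp add: descending_def atLeast0LessThan)

lemma descending_nth_mono: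
  assumes "i \<le> j" "j < N"
  shows "descending N c ! j \<le> descending N c ! i"
proof -
  let ?s = "sort (map c [0..<N])"
  have "?s ! (N - Suc j) \<le> ?s ! (N - Suc i)"
    using assms by (intro sorted_nth_mono) auto
  then show ?thesis using assms by (simp add: descending_def rev_nth)
qed

lemma descending_eqI:
  assumes "mset xs = image_mset c (mset_set {..<N})" "sorted (rev xs)"
  shows "descending N c = xs"
proof -
  have "mset (rev xs) = mset (map c [0..<N])"
    using assms(1) by (simp add: atLeast0LessThan)
  then have "sort (map c [0..<N]) = rev xs"
    using assms(2) by (metis properties_for_sort)
  then show ?thesis by (simp add: descending_def)
qed

lemma sorted_rev_descending: "sorted (rev (descending N c))"
  by (simp add: descending_def)

lemma gaps_permute:
  assumes p: "p permutes {..<N}" and d: "\<And>k. k < N \<Longrightarrow> d k = c (p k) - m"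
  shows "gaps N d = gaps N c"
proof -
  have "image_mset d (mset_set {..<N}) = image_mset (\<lambda>k. c (p k) - m) (mset_set {..<N})"
    by (rule image_mset_cong) (simp add: d)
  also have "\<dots> = image_mset (\<lambda>v. v - m) (image_mset c (image_mset p (mset_set {..<N})))"
    by (simp add: multiset.map_comp comp_def)
  also have "image_mset p (mset_set {..<N}) = mset_set {..<N}"
    using p by (simp add: image_mset_mset_set permutes_inj_on permutes_image)
  finally have "descending N d = map (\<lambda>v. v - m) (descending N c)"
    using sorted_rev_descending[of N c]
    by (intro descending_eqI)
       (auto simp: mset_descending rev_map sorted_wrt_map sorted_iff_nth_mono)
  then show ?thesis
    by (auto simp: gaps_def)
qed

lemma configuration_gaps:
  assumes N: "N \<ge> 2" and top: "card {i. i < N \<and> (\<forall>j<N. c j \<le> c i)} \<ge> 2"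
  obtains p m where "p permutes {..<N}" "\<And>k. k < N \<Longrightarrow> configuration (gaps N c) k = c (p k) - m"
proof -
  let ?s = "descending N c"
  have "mset (map c [0..<N]) = mset ?s"
    by (simp add: descending_def)
  then obtain p where p: "p permutes {..<length (map c [0..<N])}"
    "permute_list p (map c [0..<N]) = ?s"
    by (metis mset_eq_permutation)
  then have pN: "p permutes {..<N}" by simp
  have s: "?s ! k = c (p k)" if "k < N" for k
  proof -
    have "p k < N" using permutes_in_image[OF pN, of k] that by simp
    then show ?thesis
      using permute_list_nth[OF p(1), of k] p(2) that by simp
  qed
  have eq01: "?s ! 0 = ?s ! 1"
  proof -
    obtain i j where ij: "i \<noteq> j" "i < N" "j < N" "\<forall>l<N. c l \<le> c i" "\<forall>l<N. c l \<le> c j"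
    proof -
      have "\<not> is_singleton {i. i < N \<and> (\<forall>j<N. c j \<le> c i)}"
        using top by (auto simp: is_singleton_altdef)
      moreover have "{i. i < N \<and> (\<forall>j<N. c j \<le> c i)} \<noteq> {}"
        using top by (metis card.empty not_numeral_le_zero)
      ultimately show thesis
        using that is_singletonI' by (metis (mono_tags, lifting) mem_Collect_eq)
    qed
    define i' where "i' = (if inv p i = 0 then inv p j else inv p i)"
    have "inv p i \<noteq> inv p j"
      using ij(1) pN by (metis permutes_inverses(1))
    then have i'0: "i' \<noteq> 0" by (auto simp: i'_def)
    have pi': "p i' = i \<or> p i' = j"
      using pN by (auto simp: i'_def permutes_inverses)
    have i'N: "i' < N"
      using pi' ij permutes_in_image[OF pN, of i'] by auto
    have "?s ! 0 \<le> ?s ! i'"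
      using s[of 0] s[OF i'N] pi' ij N permutes_in_image[OF pN, of 0] by auto
    moreover have "?s ! i' \<le> ?s ! 1" using i'0 i'N by (intro descending_nth_mono) auto
    moreover have "?s ! 1 \<le> ?s ! 0" using N by (intro descending_nth_mono) auto
    ultimately show ?thesis by simp
  qed
  have conf: "configuration (gaps N c) (Suc k) = ?s ! Suc k - ?s ! 0" if "Suc k < N" for k
    using that
  proof (induction k)
    case 0
    then show ?case by (simp add: configuration_def eq01)
  next
    case (Suc k)
    have "k < length (gaps N c)" using Suc.prems by (simp add: gaps_def)
    then have "configuration (gaps N c) (Suc (Suc k))
        = configuration (gaps N c) (Suc k) - int (gaps N c ! k)"
      by (simp add: configuration_def take_Suc_conv_app_nth)
    moreover have "int (gaps N c ! k) = ?s ! Suc k - ?s ! Suc (Suc k)"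
      using Suc.prems descending_nth_mono[of "Suc k" "Suc (Suc k)" N c]
      by (simp add: gaps_def)
    ultimately show ?case using Suc by simp
  qed
  have "configuration (gaps N c) k = c (p k) - ?s ! 0" if "k < N" for k
  proof (cases k)
    case 0
    then show ?thesis using s[of 0] N by (simp add: configuration_def)
  next
    case (Suc l)
    then show ?thesis using conf[of l] s[of k] that by simp
  qed
  then show thesis using that pN by blast
qed

lemma gaps_configuration:
  assumes "N \<ge> 3" "length x = N - 2"
  shows "gaps N (configuration x) = x"
proof -
  have anti: "configuration x j \<le> configuration x i" if "i \<le> j" for i j
  proof -
    have "j - 1 = (i - 1) + (j - 1 - (i - 1))" using that by simp
    then have "take (j - 1) x = take (i - 1) x @ take (j - 1 - (i - 1)) (drop (i - 1) x)"
      by (metis take_add)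
    then show ?thesis by (simp add: configuration_def)
  qed
  have "descending N (configuration x) = map (configuration x) [0..<N]"
    by (intro descending_eqI)
       (auto simp: atLeast0LessThan rev_map sorted_wrt_map sorted_wrt_rev
          sorted_wrt_iff_nth_less rev_nth intro!: anti)
  then show ?thesis
    using assms
    by (intro nth_equalityI)
       (auto simp: gaps_def configuration_def take_Suc_conv_app_nth)
qed

text \<open>The gap process is a Markov chain with kernel \<^const>\<open>gap_kernel\<close>: the law of the gaps after one
  step depends on the configuration only through its gaps.\<close>

lemma map_pmf_gaps_update:
  assumes N: "N \<ge> 2" and top: "card {i. i < N \<and> (\<forall>j<N. c j \<le> c i)} \<ge> 2"
  shows "map_pmf (\<lambda>P. gaps N (update c P)) (pmf_of_set (counter_pairs N))
           = gap_kernel N (gaps N c)"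
proof -
  obtain p m where p: "p permutes {..<N}"
    and conf: "\<And>k. k < N \<Longrightarrow> configuration (gaps N c) k = c (p k) - m"
    using configuration_gaps[OF N top] by blast
  have inj: "inj p" using p by (rule permutes_inj)
  have bij: "bij_betw ((`) p) (counter_pairs N) (counter_pairs N)"
  proof (rule bij_betwI[where g = "(`) (inv p)"])
    show "(`) p \<in> counter_pairs N \<rightarrow> counter_pairs N"
      using p permutes_in_image[OF p] inj
      by (auto simp: counter_pairs_def card_image inj_on_subset)
    have q: "inv p permutes {..<N}" using p by (rule permutes_inv)
    then show "(`) (inv p) \<in> counter_pairs N \<rightarrow> counter_pairs N"
      using permutes_in_image[OF q] permutes_inj[OF q]
      by (auto simp: counter_pairs_def card_image inj_on_subset)
  qed (use p in \<open>auto simp: image_image permutes_inverses\<close>)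
  have "gaps N (update (configuration (gaps N c)) P) = gaps N (update c (p ` P))"
    if "P \<in> counter_pairs N" for P
  proof (rule gaps_permute[OF p])
    fix k assume "k < N"
    moreover have "P \<subseteq> {..<N}" using that by (simp add: counter_pairs_def)
    ultimately show "update (configuration (gaps N c)) P k = update c (p ` P) (p k) - m"
      using inj by (auto simp: update_def updated_def conf inj_image_mem_iff subset_iff)
  qed
  then have "gap_kernel N (gaps N c)
      = map_pmf (\<lambda>P. gaps N (update c (p ` P))) (pmf_of_set (counter_pairs N))"
    unfolding gap_kernel_def
    by (intro map_pmf_cong refl) (simp add: counter_pairs_nonempty N)
  also have "\<dots> = map_pmf (\<lambda>P. gaps N (update c P))
      (map_pmf ((`) p) (pmf_of_set (counter_pairs N)))"
    by (simp add: map_pmf_comp)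
  also have "map_pmf ((`) p) (pmf_of_set (counter_pairs N)) = pmf_of_set (counter_pairs N)"
    using bij by (rule map_pmf_of_set_bij_betw) (simp_all add: counter_pairs_nonempty N)
  finally show ?thesis by simp
qed

text \<open>With \<open>a\<close> the number of counters at level \<open>v\<close>, this is the formula
  \<open>1 + \<Sum>\<^sub>i \<alpha>\<^sub>i (\<alpha>\<^sub>i - 1) / (N (N - 1))\<close>.\<close>

lemma expected_updates_eq:
  assumes N: "N \<ge> 2"
  shows "expected_updates N c = 1 + (\<Sum>v\<in>c ` {..<N}. let a = real (card {i. i < N \<and> c i = v})
           in a * (a - 1) / (real N * (real N - 1)))"
proof -
  define L where "L v = {i. i < N \<and> c i = v}" for v
  define E where "E v = {P. P \<subseteq> L v \<and> card P = 2}" for v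
  have finL: "finite (L v)" for v by (simp add: L_def)
  have finE: "finite (E v)" for v
    by (rule finite_subset[of _ "Pow (L v)"]) (auto simp: E_def L_def)
  have cardE: "card (E v) = card (L v) choose 2" for v
    unfolding E_def using n_subsets[OF finL] by simp
  have sub: "(\<Union>v\<in>c ` {..<N}. E v) \<subseteq> counter_pairs N"
    by (auto simp: E_def L_def counter_pairs_def)
  have upd: "real (card (updated c P)) = 1 + of_bool (P \<in> (\<Union>v\<in>c ` {..<N}. E v))"
    if P: "P \<in> counter_pairs N" for P
  proof -
    obtain i j where ij: "P = {i, j}" "i \<noteq> j" "i < N" "j < N"
      using P by (auto simp: counter_pairs_def card_2_iff)
    have 1: "P \<in> (\<Union>v\<in>c ` {..<N}. E v) \<longleftrightarrow> c i = c j"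
      using ij by (auto simp: E_def L_def)
    have 2: "updated c P = (if c i = c j then {i, j} else if c i < c j then {i} else {j})"
      using ij by (auto simp: updated_def)
    show ?thesis unfolding 1 2 using ij(2) by simp
  qed
  have "expected_updates N c
      = (\<Sum>P\<in>counter_pairs N. real (card (updated c P))) / real (N choose 2)"
    unfolding expected_updates_def using counter_pairs_nonempty[OF N]
    by (simp add: integral_pmf_of_set card_counter_pairs)
  also have "(\<Sum>P\<in>counter_pairs N. real (card (updated c P)))
      = (\<Sum>P\<in>counter_pairs N. 1 + of_bool (P \<in> (\<Union>v\<in>c ` {..<N}. E v)))"
    by (rule sum.cong[OF refl upd])
  also have "\<dots> = real (N choose 2) + real (card (\<Union>v\<in>c ` {..<N}. E v))"
  proof -
    have "counter_pairs N \<inter> {P. P \<in> (\<Union>v\<in>c ` {..<N}. E v)} = (\<Union>v\<in>c ` {..<N}. E v)"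
      using sub by blast
    then show ?thesis
      by (simp only: sum.distrib sum_of_bool_eq finite_counter_pairs sum_constant
          card_counter_pairs mult_1_right of_nat_1)
  qed
  also have "card (\<Union>v\<in>c ` {..<N}. E v) = (\<Sum>v\<in>c ` {..<N}. card (E v))"
  proof (rule card_UN_disjoint)
    show "\<forall>v\<in>c ` {..<N}. \<forall>w\<in>c ` {..<N}. v \<noteq> w \<longrightarrow> E v \<inter> E w = {}"
    proof (intro ballI impI)
      fix v w :: int assume "v \<noteq> w"
      then have "L v \<inter> L w = {}" by (auto simp: L_def)
      then show "E v \<inter> E w = {}"
        unfolding E_def by (auto simp: card_2_iff)
    qed
  qed (auto simp: finE)
  finally have *: "expected_updates N c
      = (real (N choose 2) + (\<Sum>v\<in>c ` {..<N}. real (card (L v) choose 2))) / real (N choose 2)"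
    by (simp add: cardE)
  have ch: "real (n choose 2) = real n * (real n - 1) / 2" for n
    by (simp add: binomial_gbinomial gbinomial_prod_rev numeral_2_eq_2)
  have "real N * (real N - 1) \<noteq> 0" using N by simp
  then show ?thesis
    unfolding * ch by (simp add: add_divide_distrib Let_def L_def flip: sum_divide_distrib)
qed

end

theory Submission
  imports Defs "HOL-Real_Asymp.Real_Asymp"
begin

text \<open>Let \<open>u\<^sub>k\<close> and \<open>w\<^sub>k\<close> be the numbers of counters strictly above, respectively not below,
  counter \<open>k\<close>, so that \<open>w\<^sub>k - u\<^sub>k\<close> counters share its level. The dispersion
  \<open>\<Sum>\<^sub>i\<^sub>,\<^sub>j |c\<^sub>i - c\<^sub>j|\<close> has bounded increments, hence mean drift 0 under any stationary
  distribution. Summed over all pairs of counters its drift is \<open>2 \<Sum>\<^sub>k (N - 2 u\<^sub>k) w\<^sub>k\<close> up to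
  \<open>O(N\<^sup>2)\<close>. With \<open>\<Sum>\<^sub>k (u\<^sub>k + w\<^sub>k) = N\<^sup>2\<close> and \<open>\<Sum>\<^sub>k (w\<^sub>k\<^sup>2 + w\<^sub>k u\<^sub>k + u\<^sub>k\<^sup>2) = N\<^sup>3\<close>, and writing
  \<open>S\<^sub>p\<close> for the sum over the occupied levels of the \<open>p\<close>-th powers of the fractions of counters
  there, zero drift reads \<open>1 + E S\<^sub>2 = 4/3 (1 - E S\<^sub>3) + O(1/N)\<close>. Since \<open>S\<^sub>3 \<ge> S\<^sub>2/2 - 1/16\<close>, this gives
  \<open>E S\<^sub>2 \<le> 1/4 + O(1/N)\<close>, so the speed is even at most \<open>5/4 + O(1/N)\<close>.\<close>


section \<open>Symmetrised sums and counting identities for levels\<close>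

lemma sum_symmetrize:
  fixes f :: "'a \<Rightarrow> 'a \<Rightarrow> real"
  shows "(\<Sum>i\<in>A. \<Sum>j\<in>A. f i j) = (\<Sum>i\<in>A. \<Sum>j\<in>A. f i j + f j i) / 2"
proof -
  have "(\<Sum>i\<in>A. \<Sum>j\<in>A. f j i) = (\<Sum>i\<in>A. \<Sum>j\<in>A. f i j)" by (rule sum.swap)
  then show ?thesis by (simp add: sum.distrib)
qed

text \<open>Lets an identity between triple sums be checked on a single triple and its
  rotations.\<close>

lemma sum_cyclic:
  fixes f :: "'a \<Rightarrow> 'a \<Rightarrow> 'a \<Rightarrow> real"
  shows "3 * (\<Sum>i\<in>A. \<Sum>j\<in>A. \<Sum>k\<in>A. f i j k)
    = (\<Sum>i\<in>A. \<Sum>j\<in>A. \<Sum>k\<in>A. f i j k + f j k i + f k i j)"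
proof -
  have 1: "(\<Sum>i\<in>A. \<Sum>j\<in>A. \<Sum>k\<in>A. g j k i) = (\<Sum>i\<in>A. \<Sum>j\<in>A. \<Sum>k\<in>A. g i j k)"
    for g :: "'a \<Rightarrow> 'a \<Rightarrow> 'a \<Rightarrow> real"
  proof -
    have "(\<Sum>i\<in>A. \<Sum>j\<in>A. \<Sum>k\<in>A. g j k i) = (\<Sum>j\<in>A. \<Sum>i\<in>A. \<Sum>k\<in>A. g j k i)"
      by (rule sum.swap)
    also have "\<dots> = (\<Sum>j\<in>A. \<Sum>k\<in>A. \<Sum>i\<in>A. g j k i)"
      by (intro sum.cong refl sum.swap)
    finally show ?thesis .
  qed
  show ?thesis
    using 1[of f] 1[of "\<lambda>i j k. f j k i"] by (simp add: sum.distrib)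
qed

definition above :: "nat \<Rightarrow> (nat \<Rightarrow> int) \<Rightarrow> nat \<Rightarrow> real" where
  "above N c k = (\<Sum>j<N. of_bool (c k < c j))"

text \<open>Each counter \<open>k < N\<close> counts itself here, hence the terms
  \<open>at_least N c k - 1\<close> below.\<close>

definition at_least :: "nat \<Rightarrow> (nat \<Rightarrow> int) \<Rightarrow> nat \<Rightarrow> real" where
  "at_least N c k = (\<Sum>j<N. of_bool (c k \<le> c j))"

lemma above_bounds: "0 \<le> above N c k" "above N c k \<le> at_least N c k" "at_least N c k \<le> N"
proof -
  show "0 \<le> above N c k" unfolding above_def by (intro sum_nonneg) simp
  show "above N c k \<le> at_least N c k"
    unfolding above_def at_least_def by (intro sum_mono) (auto simp: of_bool_def)
  have "at_least N c k \<le> (\<Sum>j<N. 1)"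
    unfolding at_least_def by (intro sum_mono) (auto simp: of_bool_def)
  then show "at_least N c k \<le> N" by simp
qed

lemma sum_above_at_least: "(\<Sum>k<N. above N c k + at_least N c k) = real N ^ 2"
proof -
  have "(\<Sum>k<N. above N c k + at_least N c k)
      = (\<Sum>k<N. \<Sum>j<N. of_bool (c k < c j) + of_bool (c k \<le> c j))"
    by (simp add: above_def at_least_def sum.distrib)
  also have "\<dots> = (\<Sum>k<N. \<Sum>j<N. 2) / 2"
    by (subst sum_symmetrize) (intro arg_cong[where f = "\<lambda>x. x / 2"] sum.cong refl, auto)
  finally show ?thesis by (simp add: power2_eq_square)
qed

text \<open>A level with w - u counters contributes w^3 - u^3 in total, which telescopes over the
  levels. The proof counts triples instead, crediting each one to its lowest counters.\<close>

lemma sum_cubes: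
  "(\<Sum>k<N. at_least N c k ^ 2 + at_least N c k * above N c k + above N c k ^ 2) = real N ^ 3"
proof -
  define f :: "nat \<Rightarrow> nat \<Rightarrow> nat \<Rightarrow> real" where
    "f k i j = of_bool (c k \<le> c i) * of_bool (c k \<le> c j)
      + of_bool (c k \<le> c i) * of_bool (c k < c j) + of_bool (c k < c i) * of_bool (c k < c j)" for k i j
  \<comment> \<open>The lowest counters of a triple share a credit of 3: all of it for one, 2 and 1
    for two, 1 each for three. The asymmetric middle term of \<open>f\<close> splits the two-way
    tie.\<close>
  have cyc: "f k i j + f i j k + f j k i = 3" for k i j
    unfolding f_def
    by (cases "c k" "c i" rule: linorder_cases; cases "c i" "c j" rule: linorder_cases;
        cases "c k" "c j" rule: linorder_cases; simp)
  have "(\<Sum>k<N. at_least N c k ^ 2 + at_least N c k * above N c k + above N c k ^ 2)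
      = (\<Sum>k<N. \<Sum>i<N. \<Sum>j<N. f k i j)"
  proof (rule sum.cong[OF refl])
    fix k
    show "at_least N c k ^ 2 + at_least N c k * above N c k + above N c k ^ 2 = (\<Sum>i<N. \<Sum>j<N. f k i j)"
      by (simp only: f_def power2_eq_square above_def at_least_def sum_product sum.distrib)
  qed
  moreover have "3 * (\<Sum>k<N. \<Sum>i<N. \<Sum>j<N. f k i j) = 3 * real N ^ 3"
    unfolding sum_cyclic cyc by (simp add: power3_eq_cube)
  ultimately show ?thesis by simp
qed

text \<open>Counter \<open>k\<close> moves exactly when its partner is another counter not below it,
  which happens for \<open>at_least N c k - 1\<close> pairs.\<close>

lemma sum_updated:
  fixes f :: "nat \<Rightarrow> real"
  shows "(\<Sum>P\<in>counter_pairs N. \<Sum>k\<in>updated c P. f k) = (\<Sum>k<N. (at_least N c k - 1) * f k)"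
proof -
  have "(\<Sum>P\<in>counter_pairs N. \<Sum>k\<in>updated c P. f k)
      = (\<Sum>P\<in>counter_pairs N. \<Sum>k<N. of_bool (k \<in> updated c P) * f k)"
  proof (rule sum.cong[OF refl])
    fix P assume "P \<in> counter_pairs N"
    then have "{..<N} \<inter> {k. k \<in> updated c P} = updated c P"
      by (auto simp: counter_pairs_def updated_def)
    then show "(\<Sum>k\<in>updated c P. f k) = (\<Sum>k<N. of_bool (k \<in> updated c P) * f k)"
      by simp
  qed
  also have "\<dots> = (\<Sum>k<N. (\<Sum>P\<in>counter_pairs N. of_bool (k \<in> updated c P)) * f k)"
    by (subst sum.swap) (simp only: sum_distrib_right)
  also have "\<dots> = (\<Sum>k<N. (at_least N c k - 1) * f k)"
  proof (rule sum.cong[OF refl])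
    fix k assume k: "k \<in> {..<N}"
    have "{P \<in> counter_pairs N. k \<in> updated c P} = (\<lambda>l. {k, l}) ` ({l. l < N \<and> c k \<le> c l} - {k})"
      using k by (auto simp: counter_pairs_def updated_def card_2_iff)
    moreover have "inj_on (\<lambda>l. {k, l}) ({l. l < N \<and> c k \<le> c l} - {k})"
      by (auto simp: inj_on_def doubleton_eq_iff)
    ultimately have "card {P \<in> counter_pairs N. k \<in> updated c P} = card ({l. l < N \<and> c k \<le> c l} - {k})"
      by (simp add: card_image)
    moreover have "card {l. l < N \<and> c k \<le> c l} = Suc (card ({l. l < N \<and> c k \<le> c l} - {k}))"
      using k by (subst card.remove[of _ k]) auto
    moreover have "at_least N c k = card {l. l < N \<and> c k \<le> c l}"
      by (simp add: at_least_def lessThan_def Collect_conj_eq)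
    moreover have "(\<Sum>P\<in>counter_pairs N. of_bool (k \<in> updated c P) :: real)
        = card {P \<in> counter_pairs N. k \<in> updated c P}"
      by (simp add: Collect_conj_eq)
    ultimately show "(\<Sum>P\<in>counter_pairs N. of_bool (k \<in> updated c P)) * f k = (at_least N c k - 1) * f k"
      by simp
  qed
  finally show ?thesis .
qed

section \<open>Dispersion and its one-step increments\<close>

definition dispersion :: "nat \<Rightarrow> (nat \<Rightarrow> int) \<Rightarrow> real" where
  "dispersion N c = (\<Sum>i<N. \<Sum>j<N. real_of_int \<bar>c i - c j\<bar>)"

lemma dispersion_permute:
  assumes p: "p permutes {..<N}" and d: "\<And>k. k < N \<Longrightarrow> d k = c (p k) - m"
  shows "dispersion N d = dispersion N c"
proof -
  have "dispersion N d = (\<Sum>i<N. \<Sum>j<N. real_of_int \<bar>c (p i) - c (p j)\<bar>)"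
    by (simp add: dispersion_def d)
  also have "\<dots> = dispersion N c"
    unfolding dispersion_def
    using sum.permute[OF p, of "\<lambda>i. \<Sum>j<N. real_of_int \<bar>c i - c j\<bar>"]
      sum.permute[OF p, of "\<lambda>j. real_of_int \<bar>c (p i) - c j\<bar>" for i]
    by (simp add: comp_def)
  finally show ?thesis .
qed

text \<open>Counters move by 0 or 1, so each of the N^2 distances changes by at most 1. This is the
  bound on increments that the stationary drift argument requires.\<close>

lemma dispersion_update_bound: "\<bar>dispersion N (update c P) - dispersion N c\<bar> \<le> real N ^ 2"
proof -
  let ?d = "\<lambda>i j. real_of_int \<bar>update c P i - update c P j\<bar> - real_of_int \<bar>c i - c j\<bar>"
  have "\<bar>\<Sum>i<N. \<Sum>j<N. ?d i j\<bar> \<le> (\<Sum>i<N. \<bar>\<Sum>j<N. ?d i j\<bar>)"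
    by (rule sum_abs)
  also have "\<dots> \<le> (\<Sum>i<N. \<Sum>j<N. 1)"
  proof (intro sum_mono order_trans[OF sum_abs])
    fix i j
    show "\<bar>?d i j\<bar> \<le> 1"
      by (cases "i \<in> updated c P"; cases "j \<in> updated c P") (simp_all add: update_def abs_if)
  qed
  finally show ?thesis by (simp add: dispersion_def sum_subtractf power2_eq_square)
qed

text \<open>If only \<open>i\<close> moves, its distance to \<open>j\<close> grows by 1 when
  \<open>j\<close> is not above \<open>i\<close> and shrinks by 1 otherwise; the factor 2 comes from
  ordered pairs. Distances among updated counters stay 0: the term \<open>?q i * ?q j\<close>
  corrects for them, also at \<open>i = j\<close>, and costs at most 2 per updated counter.\<close>

lemma dispersion_update_ge:
  assumes "P \<in> counter_pairs N"
  shows "dispersion N (update c P) - dispersion N c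
    \<ge> 2 * (\<Sum>k\<in>updated c P. real N - 2 * above N c k - 2)"
proof -
  let ?Q = "updated c P"
  let ?s = "\<lambda>i j. 1 - 2 * of_bool (c i < c j) :: real"
  let ?q = "\<lambda>i. of_bool (i \<in> ?Q) :: real"
  let ?g = "\<lambda>i j. ?q i * ?s i j - ?q i * ?q j"
  have QN: "?Q \<subseteq> {..<N}" and QP: "?Q \<subseteq> P" and P: "card P = 2"
    using assms by (auto simp: updated_def counter_pairs_def)
  have finP: "finite P" using P by (metis card.infinite zero_neq_numeral)
  have cQ: "real (card ?Q) \<le> 2"
    using card_mono[OF finP QP] P by simp
  have Qint: "{..<N} \<inter> {k. k \<in> ?Q} = ?Q" using QN by auto
  have "(\<Sum>k\<in>?Q. real N - 2 * above N c k - 2) \<le> (\<Sum>k\<in>?Q. real N - 2 * above N c k - card ?Q)"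
    using cQ by (intro sum_mono) simp
  also have "\<dots> = (\<Sum>i<N. ?q i * (real N - 2 * above N c i - card ?Q))"
    using Qint by simp
  also have "\<dots> = (\<Sum>i<N. \<Sum>j<N. ?g i j)"
  proof (rule sum.cong[OF refl])
    fix i
    have "(\<Sum>j<N. ?g i j) = ?q i * (\<Sum>j<N. ?s i j - ?q j)"
      by (simp only: sum_distrib_left right_diff_distrib)
    also have "(\<Sum>j<N. ?s i j - ?q j) = real N - 2 * above N c i - card ?Q"
      using Qint by (simp add: sum_subtractf above_def sum_distrib_left)
    finally show "?q i * (real N - 2 * above N c i - card ?Q) = (\<Sum>j<N. ?g i j)" by simp
  qed
  also have "2 * \<dots> = (\<Sum>i<N. \<Sum>j<N. ?g i j + ?g j i)"
    by (subst sum_symmetrize) simp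
  also have "\<dots> \<le> (\<Sum>i<N. \<Sum>j<N. real_of_int \<bar>update c P i - update c P j\<bar> - real_of_int \<bar>c i - c j\<bar>)"
    by (intro sum_mono) (auto simp: update_def of_bool_def split: if_splits)
  also have "\<dots> = dispersion N (update c P) - dispersion N c"
    by (simp add: dispersion_def sum_subtractf)
  finally show ?thesis by simp
qed


section \<open>Bounding the expected updates by the drift\<close>

lemma expected_updates_at_least:
  assumes "N \<ge> 2"
  shows "expected_updates N c = (\<Sum>k<N. at_least N c k - 1) / real (N choose 2)"
  using sum_updated[where N = N and c = c and f = "\<lambda>_. 1"] counter_pairs_nonempty[OF assms]
  by (simp add: expected_updates_def integral_pmf_of_set card_counter_pairs)

lemma sum_dispersion_increments_ge:
  "(\<Sum>P\<in>counter_pairs N. dispersion N (update c P) - dispersion N c)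
    \<ge> 2 * (\<Sum>k<N. (at_least N c k - 1) * (real N - 2 * above N c k - 2))"
proof -
  have "2 * (\<Sum>k<N. (at_least N c k - 1) * (real N - 2 * above N c k - 2))
      = (\<Sum>P\<in>counter_pairs N. 2 * (\<Sum>k\<in>updated c P. real N - 2 * above N c k - 2))"
    by (simp only: sum_updated sum_distrib_left[symmetric])
  also have "\<dots> \<le> (\<Sum>P\<in>counter_pairs N. dispersion N (update c P) - dispersion N c)"
    by (intro sum_mono dispersion_update_ge)
  finally show ?thesis .
qed

text \<open>The difference \<open>at_least N c k - above N c k\<close> is the occupancy of the level
  of \<open>k\<close>, so the left side is N^3 S_2. The drift bound stays as a linear term: the
  estimate then holds for every configuration, and that term can be averaged away.\<close>

lemma sum_at_least_bound:
  "real N * (\<Sum>k<N. at_least N c k - above N c k)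
    \<le> real N ^ 3 / 4 + 18 / 5 * real N ^ 2
      + 6 / 5 * (\<Sum>k<N. (at_least N c k - 1) * (real N - 2 * above N c k - 2))"
proof -
  let ?n = "real N"
  let ?f = "\<lambda>k. ?n * (at_least N c k - above N c k)"
  let ?g = "\<lambda>k. (at_least N c k - 1) * (?n - 2 * above N c k - 2)"
  let ?h2 = "\<lambda>k. above N c k + at_least N c k"
  let ?h3 = "\<lambda>k. at_least N c k ^ 2 + at_least N c k * above N c k + above N c k ^ 2"
  \<comment> \<open>The last two terms below vanish when summed over \<open>k\<close>; their coefficients make the remainder a
    square up to lower-order terms.\<close>
  have lin: "(\<Sum>k<N. p + q + r * g k + s * (h3 k - t) - u * (h2 k - v))
      = ?n * p + ?n * q + r * sum g {..<N} + s * (sum h3 {..<N} - ?n * t) - u * (sum h2 {..<N} - ?n * v)"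
    for p q r s t u v :: real and g h2 h3 :: "nat \<Rightarrow> real"
    by (simp only: sum.distrib sum_subtractf sum_distrib_left[symmetric] sum_constant card_lessThan)
  have "?f k \<le> ?n^2 / 4 + 18 / 5 * ?n + 6 / 5 * ?g k + 4 / 5 * (?h3 k - ?n^2) - 3 / 5 * ?n * (?h2 k - ?n)" for k
  proof -
    let ?a = "at_least N c k - above N c k"
    \<comment> \<open>The square is the pointwise form of S_3 \<ge> S_2/2 - 1/16. It vanishes at
      \<open>?n / 4\<close> because four equal levels balance the drift to leading order: 1 + 1/4 =
      4/3 (1 - 1/16). The constant 18/5 leaves a nonnegative linear remainder.\<close>
    have "?n^2 / 4 + 18 / 5 * ?n + 6 / 5 * ?g k + 4 / 5 * (?h3 k - ?n^2) - 3 / 5 * ?n * (?h2 k - ?n) - ?f k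
        = 4 / 5 * (?a - ?n / 4)^2 + 12 / 5 * (?n - ?a) + 12 / 5"
      by (simp add: field_simps power2_eq_square)
    also have "\<dots> \<ge> 0"
      using above_bounds[where N = N and c = c and k = k] by simp
    finally show ?thesis by (simp only: diff_ge_0_iff_ge)
  qed
  then have "(\<Sum>k<N. ?f k) \<le> (\<Sum>k<N. ?n^2 / 4 + 18 / 5 * ?n + 6 / 5 * ?g k
      + 4 / 5 * (?h3 k - ?n^2) - 3 / 5 * ?n * (?h2 k - ?n))"
    by (rule sum_mono)
  also have "\<dots> = ?n * (?n^2 / 4) + ?n * (18 / 5 * ?n) + 6 / 5 * (\<Sum>k<N. ?g k)
      + 4 / 5 * ((\<Sum>k<N. ?h3 k) - ?n * ?n^2) - 3 / 5 * ?n * ((\<Sum>k<N. ?h2 k) - ?n * ?n)"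
    by (rule lin)
  also have "\<dots> = ?n ^ 3 / 4 + 18 / 5 * ?n ^ 2 + 6 / 5 * (\<Sum>k<N. ?g k)"
    unfolding sum_cubes sum_above_at_least by (simp add: power2_eq_square power3_eq_cube)
  finally show ?thesis by (simp add: sum_distrib_left)
qed

lemma expected_updates_le:
  assumes N: "N \<ge> 2"
  shows "expected_updates N c \<le> (5 / 4 * real N + 8 / 5) / (real N - 1)
    + 3 / (10 * real N) * measure_pmf.expectation (pmf_of_set (counter_pairs N))
        (\<lambda>P. dispersion N (update c P) - dispersion N c)"
proof -
  let ?n = "real N"
  define T where "T = (\<Sum>P\<in>counter_pairs N. dispersion N (update c P) - dispersion N c)"
  define a where "a = (\<Sum>k<N. at_least N c k - above N c k)"
  define b where "b = ?n * (?n - 1) / 2"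
  define t where "t = T / ?n"
  have n: "?n \<ge> 2" using N by simp
  have ch: "real (N choose 2) = b"
    by (simp add: binomial_gbinomial gbinomial_prod_rev numeral_2_eq_2 b_def)
  have bpos: "b > 0" using n by (simp add: b_def)
  \<comment> \<open>\<open>T\<close> is at least twice the drift sum, which turns the factor 6/5
    into 3/5.\<close>
  have "?n * a \<le> ?n ^ 3 / 4 + 18 / 5 * ?n ^ 2 + 3 / 5 * T"
    using sum_at_least_bound[of N c] sum_dispersion_increments_ge[of N c] by (simp add: T_def a_def)
  then have "a \<le> (?n ^ 3 / 4 + 18 / 5 * ?n ^ 2 + 3 / 5 * T) / ?n"
    using n by (simp add: field_simps)
  also have "\<dots> = ?n ^ 2 / 4 + 18 / 5 * ?n + 3 / 5 * t"
    using n by (simp add: t_def field_simps power2_eq_square power3_eq_cube)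
  finally have a: "a \<le> ?n ^ 2 / 4 + 18 / 5 * ?n + 3 / 5 * t" .
  have "(\<Sum>k<N. at_least N c k - 1) = (?n ^ 2 + a) / 2 - ?n"
    using sum_above_at_least[of N c] by (simp add: a_def sum.distrib sum_subtractf)
  also have "\<dots> \<le> 5 / 8 * ?n ^ 2 + 4 / 5 * ?n + 3 / 10 * t"
    using a by (simp add: field_simps)
  finally have "expected_updates N c \<le> (5 / 8 * ?n ^ 2 + 4 / 5 * ?n + 3 / 10 * t) / b"
    using bpos by (simp add: expected_updates_at_least[OF N] ch divide_right_mono)
  also have "\<dots> = (5 / 4 * ?n + 8 / 5) / (?n - 1) + 3 / (10 * ?n) * (T / b)"
    using n by (simp add: b_def t_def divide_simps power2_eq_square) (simp add: algebra_simps)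
  also have "T / b = measure_pmf.expectation (pmf_of_set (counter_pairs N))
        (\<lambda>P. dispersion N (update c P) - dispersion N c)"
    using counter_pairs_nonempty[OF N] by (simp add: integral_pmf_of_set card_counter_pairs T_def ch)
  finally show ?thesis .
qed

section \<open>Dispersion as a function of the gaps\<close>

lemma dispersion_configuration_gaps:
  assumes "N \<ge> 2" "card {i. i < N \<and> (\<forall>j<N. c j \<le> c i)} \<ge> 2"
  shows "dispersion N (configuration (gaps N c)) = dispersion N c"
  using configuration_gaps[OF assms] dispersion_permute by metis

text \<open>A counter at the maximum moves only if its partner is there too. Then the pair is on top
  afterwards; otherwise nothing passes the old maximum and the old top counters stay on top.\<close>

lemma card_top_update:
  assumes top: "card {i. i < N \<and> (\<forall>j<N. c j \<le> c i)} \<ge> 2" and P: "P \<in> counter_pairs N"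
  shows "card {i. i < N \<and> (\<forall>j<N. update c P j \<le> update c P i)} \<ge> 2"
proof -
  let ?top = "\<lambda>c. {i. i < N \<and> (\<forall>j<N. c j \<le> c i)}"
  have sub2: "card A \<ge> 2" if "S \<subseteq> A" "card S \<ge> 2" "A \<subseteq> {..<N}" for A S
    using card_mono[OF finite_subset[OF that(3)] that(1)] that(2) by simp
  obtain k l where kl: "P = {k, l}" "k \<noteq> l" "k < N" "l < N"
    using P by (auto simp: counter_pairs_def card_2_iff)
  show ?thesis
  proof (cases "k \<in> ?top c \<and> l \<in> ?top c")
    case True
    then have "{k, l} \<subseteq> ?top (update c P)"
      using kl by (auto simp: update_def updated_def intro: add_mono order_antisym)
    then show ?thesis by (rule sub2) (use kl in auto)
  next
    case False
    have "update c P i \<le> c j" if "i < N" "j \<in> ?top c" for i j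
    proof (rule ccontr)
      assume "\<not> update c P i \<le> c j"
      moreover have "c i \<le> c j" using that by auto
      ultimately have i: "i \<in> updated c P" "c i = c j"
        by (auto simp: update_def split: if_splits)
      then have "c j \<le> c k" "c j \<le> c l" using kl by (auto simp: updated_def)
      then have "k \<in> ?top c \<and> l \<in> ?top c"
        using that(2) kl by (auto intro: order_trans)
      with False show False by blast
    qed
    moreover have "c j \<le> update c P j" for j by (simp add: update_def)
    ultimately have "?top c \<subseteq> ?top (update c P)" by (auto intro: order_trans)
    then show ?thesis by (rule sub2) (use top in auto)
  qed
qed

lemma card_top_configuration:
  assumes "N \<ge> 2"
  shows "card {i. i < N \<and> (\<forall>j<N. configuration x j \<le> configuration x i)} \<ge> 2"
proof -
  have "{0, 1} \<subseteq> {i. i < N \<and> (\<forall>j<N. configuration x j \<le> configuration x i)}"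
    using assms by (auto simp: configuration_def)
  then have "card {0, 1 :: nat} \<le> card {i. i < N \<and> (\<forall>j<N. configuration x j \<le> configuration x i)}"
    by (rule card_mono[rotated]) simp
  then show ?thesis by simp
qed

text \<open>Identifies the drift along the gap chain with the drift computed on
  configurations.\<close>

lemma dispersion_gaps_update:
  assumes "N \<ge> 2" "P \<in> counter_pairs N"
  shows "dispersion N (configuration (gaps N (update (configuration x) P)))
    = dispersion N (update (configuration x) P)"
  using assms by (intro dispersion_configuration_gaps card_top_update card_top_configuration)

section \<open>Zero drift under stationarity\<close>

text \<open>\<open>f\<close> need not be integrable: the truncations \<open>min (f x) n\<close> have drift 0, and their increments
  inherit the bound \<open>B\<close>, so dominated convergence applies.\<close>

lemma stationary_drift_eq_0:
  fixes f :: "'a \<Rightarrow> real"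
  assumes stat: "bind_pmf p K = p" and nonneg: "\<And>x. f x \<ge> 0"
    and bound: "\<And>x y. y \<in> set_pmf (K x) \<Longrightarrow> \<bar>f y - f x\<bar> \<le> B"
  shows "integrable p (\<lambda>x. measure_pmf.expectation (K x) (\<lambda>y. f y - f x))"
    and "measure_pmf.expectation p (\<lambda>x. measure_pmf.expectation (K x) (\<lambda>y. f y - f x)) = 0"
proof -
  define g where "g n x = min (f x) (real n)" for n x
  have g: "\<bar>g n x\<bar> \<le> n" for n x using nonneg[of x] by (simp add: g_def)
  have int: "integrable (measure_pmf q) (g n)" for q n
    by (rule measure_pmf.integrable_const_bound[where B = n]) (auto simp: g)
  have gd: "\<bar>g n y - g n x\<bar> \<le> B" if "y \<in> set_pmf (K x)" for n x y
    using bound[OF that] by (auto simp: g_def min_def)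
  define d where "d n x = measure_pmf.expectation (K x) (\<lambda>y. g n y - g n x)" for n x
  define e where "e x = measure_pmf.expectation (K x) (\<lambda>y. f y - f x)" for x
  have B: "\<bar>measure_pmf.expectation (K x) h\<bar> \<le> B" if "\<And>y. y \<in> set_pmf (K x) \<Longrightarrow> \<bar>h y\<bar> \<le> B" for x h
  proof -
    have "integrable (K x) h"
      by (rule measure_pmf.integrable_const_bound[where B = B]) (auto simp: AE_measure_pmf_iff that)
    then have "\<bar>measure_pmf.expectation (K x) h\<bar> \<le> measure_pmf.expectation (K x) (\<lambda>y. B)"
      by (intro order_trans[OF integral_abs_bound] integral_mono_AE) (auto simp: AE_measure_pmf_iff that)
    then show ?thesis by simp
  qed
  \<comment> \<open>Boundedness of \<open>g n\<close> allows the expected difference to be split;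
    stationarity makes the two parts cancel.\<close>
  have d0: "measure_pmf.expectation p (d n) = 0" for n
  proof -
    have "measure_pmf.expectation p (g n) = measure_pmf.expectation (bind_pmf p K) (g n)"
      by (simp add: stat)
    also have "\<dots> = measure_pmf.expectation p (\<lambda>x. measure_pmf.expectation (K x) (g n))"
      unfolding measure_pmf_bind
      by (rule integral_bind[where K = "count_space UNIV" and B = n and B' = 1])
        (auto simp: g measure_pmf.emeasure_space_1[simplified] measure_pmf_in_subprob_algebra
           intro: measure_pmf.finite_measure_axioms)
    finally have eq: "measure_pmf.expectation p (\<lambda>x. measure_pmf.expectation (K x) (g n))
        = measure_pmf.expectation p (g n)" ..
    have "integrable p (\<lambda>x. measure_pmf.expectation (K x) (g n))"
    proof (rule measure_pmf.integrable_const_bound[where B = n])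
      have "\<bar>measure_pmf.expectation (K x) (g n)\<bar> \<le> measure_pmf.expectation (K x) (\<lambda>y. real n)" for x
        by (intro order_trans[OF integral_abs_bound] integral_mono integrable_abs int) (auto simp: g)
      then show "AE x in p. norm (measure_pmf.expectation (K x) (g n)) \<le> n" by simp
    qed simp
    then have "measure_pmf.expectation p (\<lambda>x. measure_pmf.expectation (K x) (g n) - g n x) = 0"
      using int eq by simp
    moreover have "d n x = measure_pmf.expectation (K x) (g n) - g n x" for x
      using int by (simp add: d_def)
    ultimately show ?thesis by presburger
  qed
  have lim_g: "(\<lambda>n. g n x) \<longlonglongrightarrow> f x" for x
  proof (rule tendsto_eventually)
    obtain m where "f x \<le> real m" using real_arch_simple by blast
    then have "\<forall>n\<ge>m. g n x = f x" by (auto simp: g_def min_def)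
    then show "\<forall>\<^sub>F n in sequentially. g n x = f x" by (auto simp: eventually_sequentially)
  qed
  \<comment> \<open>First limit, inside the kernel; the second, under \<open>p\<close>, follows
    below. The constant \<open>B\<close> dominates in both.\<close>
  have lim_d: "(\<lambda>n. d n x) \<longlonglongrightarrow> e x" for x
    unfolding d_def e_def
    by (rule integral_dominated_convergence[where w = "\<lambda>_. B"])
      (auto simp: AE_measure_pmf_iff gd intro: tendsto_diff lim_g)
  have "integrable p e"
    by (rule measure_pmf.integrable_const_bound[where B = B]) (auto simp: e_def intro: B bound)
  then show "integrable p (\<lambda>x. measure_pmf.expectation (K x) (\<lambda>y. f y - f x))"
    unfolding e_def .
  have "(\<lambda>n. measure_pmf.expectation p (d n)) \<longlonglongrightarrow> measure_pmf.expectation p e"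
    by (rule integral_dominated_convergence[where w = "\<lambda>_. B"])
      (auto simp: d_def intro: lim_d[unfolded d_def] B gd)
  then have "measure_pmf.expectation p e = 0"
    unfolding d0 by (simp add: LIMSEQ_const_iff)
  then show "measure_pmf.expectation p (\<lambda>x. measure_pmf.expectation (K x) (\<lambda>y. f y - f x)) = 0"
    unfolding e_def .
qed

section \<open>Stationary average and the final bound\<close>

lemma speed_le:
  assumes N: "N \<ge> 2" and stat: "stationary N \<pi>"
  shows "speed N \<pi> \<le> (5 / 4 * real N + 8 / 5) / (real N - 1)"
proof -
  define f where "f x = dispersion N (configuration x)" for x
  let ?drift = "\<lambda>x. measure_pmf.expectation (gap_kernel N x) (\<lambda>y. f y - f x)"
  have set: "set_pmf (pmf_of_set (counter_pairs N)) = counter_pairs N"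
    using N by (simp add: counter_pairs_nonempty)
  have drift: "?drift x = measure_pmf.expectation (pmf_of_set (counter_pairs N))
      (\<lambda>P. dispersion N (update (configuration x) P) - dispersion N (configuration x))" for x
    unfolding gap_kernel_def integral_map_pmf f_def
    by (intro integral_cong_AE) (auto simp: AE_measure_pmf_iff set dispersion_gaps_update N)
  have f0: "f x \<ge> 0" for x by (simp add: f_def dispersion_def sum_nonneg)
  have fb: "\<bar>f y - f x\<bar> \<le> real N ^ 2" if "y \<in> set_pmf (gap_kernel N x)" for x y
    using that by (auto simp: gap_kernel_def set f_def dispersion_gaps_update N dispersion_update_bound)
  have bind: "bind_pmf \<pi> (gap_kernel N) = \<pi>" using stat by (simp add: stationary_def)
  note drift0 = stationary_drift_eq_0[where f = f, OF bind f0 fb]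
  let ?r = "\<lambda>x. (5 / 4 * real N + 8 / 5) / (real N - 1) + 3 / (10 * real N) * ?drift x"
  have "speed N \<pi> \<le> measure_pmf.expectation \<pi> ?r"
    unfolding speed_def
  proof (rule integral_mono_AE')
    show "integrable \<pi> ?r"
      using drift0(1) by (intro Bochner_Integration.integrable_add integrable_mult_right) auto
    have le: "expected_updates N (configuration x) \<le> ?r x" for x
      using expected_updates_le[OF N] unfolding drift .
    then show "AE x in \<pi>. expected_updates N (configuration x) \<le> ?r x" by simp
    \<comment> \<open>The comparison of integrals asks for a nonnegative upper bound;
      \<open>?r\<close> inherits this from \<open>expected_updates\<close>.\<close>
    have "expected_updates N c \<ge> 0" for c
      by (simp add: expected_updates_def)
    then show "AE x in \<pi>. 0 \<le> ?r x" using le order_trans by blast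
  qed
  also have "\<dots> = (5 / 4 * real N + 8 / 5) / (real N - 1) + 3 / (10 * real N) * measure_pmf.expectation \<pi> ?drift"
    using drift0(1) by simp
  finally show ?thesis using drift0(2) by simp
qed

theorem theorem2:
  "\<exists>\<epsilon> :: nat \<Rightarrow> real. \<epsilon> \<longlonglongrightarrow> 0 \<and>
     (\<forall>N\<ge>3. \<forall>\<pi>. stationary N \<pi> \<longrightarrow> speed N \<pi> \<le> (1 + \<epsilon> N) * (1 + 7 / 27))"
proof (intro exI[of _ "\<lambda>N. 3 / (real N - 1)"] conjI allI impI)
  show "(\<lambda>N. 3 / (real N - 1)) \<longlonglongrightarrow> 0" by real_asymp
next
  fix N :: nat and \<pi> assume N: "3 \<le> N" and stat: "stationary N \<pi>"
  have "speed N \<pi> \<le> (5 / 4 * real N + 8 / 5) / (real N - 1)"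
    using N stat by (intro speed_le) auto
  \<comment> \<open>The witness makes 1 + \<epsilon> N equal to (N + 2)/(N - 1), so the target
    numerator is 34/27 (N + 2). Coefficients compare separately: 5/4 \<le> 34/27 and 8/5 \<le>
    68/27.\<close>
  also have "\<dots> \<le> (34 / 27 * real N + 68 / 27) / (real N - 1)"
    using N by (intro divide_right_mono) auto
  also have "\<dots> = (1 + 3 / (real N - 1)) * (1 + 7 / 27)"
    using N by (simp add: field_simps)
  finally show "speed N \<pi> \<le> (1 + 3 / (real N - 1)) * (1 + 7 / 27)" .
qed

end
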